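(* Let $(\mathcal{F}_n)_{n\in\mathbb{N}}$ be a filtration of $\mathcal{F}$ and let $(X_n)$, $(A_n)$ and $(C_n)$ be sequences of nonnegative, integrable real-valued random variables adapted to $(\mathcal{F}_n)$. Suppose that for all $n\in\mathbb{N}$: \[ \mathbb{E}[X_{n+1}\mid \mathcal{F}_n]\leq (1+A_n)X_{n}+C_n\quad\text{a.s.} \] Also, suppose that there exist $K\geq 1$ and $\chi:(0,\infty)\to \mathbb{N}$ satisfying $\prod_{i=0}^\infty (1+A_i)<K$ a.s. and $\sum_{i=\chi(\varepsilon)}^\infty \mathbb{E}[C_i]<\varepsilon$ for all $\varepsilon>0$. Further, let $f:[0,\infty)\to [0,\infty)$ be s.i.c.c. with moduli $\psi$ and $\kappa$. Finally, suppose that $\varphi:(0,\infty)\times\mathbb{N}\to\mathbb{N}$ is a $\liminf$-modulus for $(f(X_{n}))$ in expectation, in the sense that \[ \forall\varepsilon>0\ \forall N\in\mathbb{N}\ \exists n\in [N;\varphi(\varepsilon,N)]\ \left(\mathbb{E}[f(X_{n})]<\varepsilon\right). \] Then $\mathbb{E}[f(X_n)]\to 0$ with rate \[ \rho(\varepsilon):=\varphi\left(\frac{\varepsilon \psi(K^{-1})}{2},\chi\left(\kappa\left(\frac{\varepsilon \psi(K^{-1})}{2}\right)\right)\right) \] and $X_n\to 0$ a.s. with rate $\rho'(\lambda,\varepsilon):=\rho(\lambda f(\varepsilon))$.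
   Context: All random variables live on a fixed probability space $(\Omega,\mathcal{F},\mathbb{P})$. For $N,m$, $[N;m]$ denotes the set of natural numbers $n$ with $N\le n\le m$. A function $f:[0,\infty)\to[0,\infty)$ is called s.i.c.c. with moduli $\psi:[0,1]\to[0,1]$ and $\kappa:(0,\infty)\to(0,\infty)$ if: (1) $f$ is $\psi$-supermultiplicative, i.e. $f(xa)\ge f(x)\psi(a)$ for all $x\in[0,\infty)$ and $a\in[0,1]$, where $\psi(x)>0$ for $x>0$; (2) $f$ is strictly increasing; (3) $f$ is concave; (4) $f$ is continuous with $f(0)=0$, and $\kappa$ is a modulus of continuity at $0$, i.e. $x<\kappa(\varepsilon)$ implies $f(x)<\varepsilon$ for all $x\in[0,\infty)$ and $\varepsilon>0$. Rates: "$\mathbb{E}[Y_n]\to0$ with rate $\rho$" (for nonnegative $Y_n$) means $\forall\varepsilon>0\ \forall n\ge\rho(\varepsilon)\ (\mathbb{E}[Y_n]<\varepsilon)$. "$X_n\to0$ a.s. with rate $\rho'$" (for nonnegative $X_n$) means $\forall\lambda,\varepsilon>0\ \left(\mathbb{P}(\exists n\ge\rho'(\lambda,\varepsilon)\ (X_n\ge\varepsilon))<\lambda\right)$. *)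

theory Defs
  imports "HOL-Probability.Probability"
begin

text \<open>
  Functions on \<open>[0,\<infinity>)\<close>, \<open>[0,1]\<close> and \<open>(0,\<infinity>)\<close> are represented by functions on \<^typ>\<open>real\<close> of which
  only the values on the stated domain are constrained.
\<close>

definition sicc :: "(real \<Rightarrow> real) \<Rightarrow> (real \<Rightarrow> real) \<Rightarrow> (real \<Rightarrow> real) \<Rightarrow> bool" where
  "sicc f \<psi> \<kappa> \<longleftrightarrow>
     f \<in> {0..} \<rightarrow> {0..} \<and> \<psi> \<in> {0..1} \<rightarrow> {0..1} \<and> \<kappa> \<in> {0<..} \<rightarrow> {0<..} \<and>
     (\<forall>x\<in>{0..}. \<forall>a\<in>{0..1}. f (x * a) \<ge> f x * \<psi> a) \<and>
     (\<forall>a\<in>{0<..1}. \<psi> a > 0) \<and>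
     strict_mono_on {0..} f \<and>
     concave_on {0..} f \<and>
     continuous_on {0..} f \<and> f 0 = 0 \<and>
     (\<forall>\<epsilon>>0. \<forall>x\<in>{0..}. x < \<kappa> \<epsilon> \<longrightarrow> f x < \<epsilon>)"

text \<open>
  Rates of convergence to \<open>0\<close> for sequences of nonnegative random variables. Integrability is part
  of the first notion because the Bochner integral of a non-integrable function is \<open>0\<close>, so that
  the inequality alone would not express that the expectation is finite and small.
\<close>

definition expectation_to_zero_with_rate ::
    "'a measure \<Rightarrow> (nat \<Rightarrow> 'a \<Rightarrow> real) \<Rightarrow> (real \<Rightarrow> nat) \<Rightarrow> bool" where
  "expectation_to_zero_with_rate M Y \<rho> \<longleftrightarrow>
     (\<forall>\<epsilon>>0. \<forall>n\<ge>\<rho> \<epsilon>. integrable M (Y n) \<and> (\<integral>\<omega>. Y n \<omega> \<partial>M) < \<epsilon>)"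

definition AE_to_zero_with_rate ::
    "'a measure \<Rightarrow> (nat \<Rightarrow> 'a \<Rightarrow> real) \<Rightarrow> (real \<Rightarrow> real \<Rightarrow> nat) \<Rightarrow> bool" where
  "AE_to_zero_with_rate M Y \<rho> \<longleftrightarrow>
     (\<forall>l>0. \<forall>\<epsilon>>0. measure M {\<omega> \<in> space M. \<exists>n\<ge>\<rho> l \<epsilon>. Y n \<omega> \<ge> \<epsilon>} < l)"

definition liminf_modulus_in_expectation ::
    "'a measure \<Rightarrow> (nat \<Rightarrow> 'a \<Rightarrow> real) \<Rightarrow> (real \<Rightarrow> nat \<Rightarrow> nat) \<Rightarrow> bool" where
  "liminf_modulus_in_expectation M Y \<phi> \<longleftrightarrow>
     (\<forall>\<epsilon>>0. \<forall>N. \<exists>n\<in>{N..\<phi> \<epsilon> N}. (\<integral>\<omega>. Y n \<omega> \<partial>M) < \<epsilon>)"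

definition nonneg_integrable_adapted ::
    "'a measure \<Rightarrow> (nat \<Rightarrow> 'a measure) \<Rightarrow> (nat \<Rightarrow> 'a \<Rightarrow> real) \<Rightarrow> bool" where
  "nonneg_integrable_adapted M F Y \<longleftrightarrow>
     (\<forall>n. (\<forall>\<omega>\<in>space M. Y n \<omega> \<ge> 0) \<and> integrable M (Y n) \<and> Y n \<in> borel_measurable (F n))"

end

theory Submission
  imports Defs
begin

text \<open>
  Normalising, \<open>V m = X m / (\<Prod>i<m. 1 + A i)\<close> satisfies \<open>E[V (m+1) | F m] \<le> V m + C m\<close>, so adding the
  conditional expectation of the remaining noise \<open>\<Sum>i=m..<T. C i\<close> up to a horizon \<open>T\<close> gives a
  nonnegative supermartingale, and by Jensen's inequality so does composing with the concave
  increasing function \<open>f\<close>. If the liminf modulus provides \<open>n\<close> with \<open>E[f (X n)]\<close> small, then by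
  subadditivity of \<open>f\<close> and Jensen's inequality the expectation of this supermartingale at time \<open>n\<close>
  is small as well, uniformly in \<open>T\<close>. Supermultiplicativity compares it with \<open>f (X m)\<close>, since
  \<open>V m \<ge> X m / K\<close>; both rates follow, the second one by Ville's maximal inequality.
\<close>

section \<open>Concave functions on the half-line\<close>

text \<open>This is concavity on the segment from 0 to \<open>x\<close>, with the contribution of
  \<open>f 0\<close> dropped by its sign.\<close>

lemma concave_on_scale_le:
  fixes f :: "real \<Rightarrow> real"
  assumes "concave_on {0..} f" "f 0 \<ge> 0" "x \<ge> 0" "0 \<le> t" "t \<le> 1"
  shows "t * f x \<le> f (t * x)"
proof -
  have "(1 - t) * f 0 + t * f x \<le> f ((1 - t) *\<^sub>R 0 + t *\<^sub>R x)"
    using assms by (intro concave_onD[of "{0..}"]) auto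
  moreover have "(1 - t) * f 0 \<ge> 0"
    using assms by simp
  ultimately show ?thesis by simp
qed

text \<open>Both \<open>x\<close> and \<open>y\<close> are fractions of \<open>x + y\<close> with
  weights summing to 1, so the scaling inequality applies to each and the two bounds add up.\<close>

lemma concave_on_subadditive:
  fixes f :: "real \<Rightarrow> real"
  assumes f: "concave_on {0..} f" "f 0 \<ge> 0" and "x \<ge> 0" "y \<ge> 0"
  shows "f (x + y) \<le> f x + f y"
proof (cases "x + y = 0")
  case True
  with assms show ?thesis by (simp add: add_nonneg_eq_0_iff)
next
  case False
  let ?s = "x + y"
  have "x / ?s * f ?s \<le> f (x / ?s * ?s)" "y / ?s * f ?s \<le> f (y / ?s * ?s)"
    using assms by (intro concave_on_scale_le; simp add: divide_le_eq)+
  moreover have "f ?s = x / ?s * f ?s + y / ?s * f ?s"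
    using False by (simp add: distrib_right[symmetric] add_divide_distrib[symmetric])
  ultimately show ?thesis using False by simp
qed

text \<open>Scaling \<open>1 + x\<close> down to 1 uses a factor of at most 1 for every
  \<open>x \<ge> 0\<close>; monotonicity then passes from \<open>1 + x\<close> to \<open>x\<close>.
  The affine bound serves as integrable majorant for compositions with \<open>f\<close>.\<close>

lemma concave_mono_linear_bound:
  fixes f :: "real \<Rightarrow> real"
  assumes "concave_on {0..} f" "f 0 \<ge> 0" "mono f" "x \<ge> 0"
  shows "f x \<le> f 1 * (1 + x)"
proof -
  have "1 / (1 + x) * f (1 + x) \<le> f (1 / (1 + x) * (1 + x))"
    using assms by (intro concave_on_scale_le) auto
  then have "f (1 + x) \<le> f 1 * (1 + x)"
    using assms by (simp add: divide_le_eq split: if_splits)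
  moreover have "f x \<le> f (1 + x)"
    using assms by (auto intro: monoD)
  ultimately show ?thesis by simp
qed

lemma (in finite_measure) integrable_concave_comp:
  fixes f :: "real \<Rightarrow> real"
  assumes f: "concave_on {0..} f" "mono f" "\<And>x. f x \<ge> 0" "f \<in> borel_measurable borel"
    and Y: "integrable M Y" "AE \<omega> in M. Y \<omega> \<ge> 0"
  shows "integrable M (\<lambda>\<omega>. f (Y \<omega>))"
proof (rule Bochner_Integration.integrable_bound)
  show "integrable M (\<lambda>\<omega>. f 1 * (1 + Y \<omega>))"
    using Y by simp
  show "(\<lambda>\<omega>. f (Y \<omega>)) \<in> borel_measurable M"
    by (rule measurable_compose[OF borel_measurable_integrable[OF Y(1)] f(4)])
  show "AE \<omega> in M. norm (f (Y \<omega>)) \<le> norm (f 1 * (1 + Y \<omega>))"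
    using Y(2)
  proof eventually_elim
    case (elim \<omega>)
    show ?case
      using concave_mono_linear_bound[OF f(1) f(3) f(2) elim] f(3)[of "Y \<omega>"] by simp
  qed
qed

section \<open>Supermartingales\<close>

text \<open>Conditional Jensen for the convex function \<open>- f\<close>, after which monotonicity
  of \<open>f\<close> replaces the conditional expectation by its bound \<open>Z\<close>. This is
  how composition with \<open>f\<close> preserves supermartingales.\<close>

lemma (in prob_space) real_cond_exp_concave_le:
  fixes f :: "real \<Rightarrow> real"
  assumes F: "subalgebra M F"
    and f: "concave_on {0..} f" "mono f" "\<And>x. f x \<ge> 0" "f \<in> borel_measurable borel"
    and Y: "integrable M Y" "AE \<omega> in M. Y \<omega> > 0"
    and le: "AE \<omega> in M. real_cond_exp M F Y \<omega> \<le> Z \<omega>"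
  shows "AE \<omega> in M. real_cond_exp M F (\<lambda>\<omega>. f (Y \<omega>)) \<omega> \<le> f (Z \<omega>)"
proof -
  interpret S: finite_measure_subalgebra M F
    by unfold_locales (rule F)
  have Y0: "AE \<omega> in M. Y \<omega> \<ge> 0"
    using Y(2) by eventually_elim simp
  have int: "integrable M (\<lambda>\<omega>. f (Y \<omega>))"
    by (rule integrable_concave_comp[OF f Y(1) Y0])
  have conv: "convex_on {0<..} (\<lambda>x. - f x)"
    by (rule convex_on_subset[of "{0..}"]) (use f(1) in \<open>auto simp: concave_on_def\<close>)
  have "AE \<omega> in M. - f (real_cond_exp M F Y \<omega>) \<le> real_cond_exp M F (\<lambda>\<omega>. - f (Y \<omega>)) \<omega>"
    by (rule S.real_cond_exp_jensens_inequality(2)[where I = "{0<..}"])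
       (use Y int conv f(4) in auto)
  moreover have "AE \<omega> in M. real_cond_exp M F (\<lambda>\<omega>. - 1 * f (Y \<omega>)) \<omega>
      = - 1 * real_cond_exp M F (\<lambda>\<omega>. f (Y \<omega>)) \<omega>"
    by (rule S.real_cond_exp_cmult[OF int])
  ultimately show ?thesis
    using le
  proof eventually_elim
    case (elim \<omega>)
    have "real_cond_exp M F (\<lambda>\<omega>. f (Y \<omega>)) \<omega> \<le> f (real_cond_exp M F Y \<omega>)"
      using elim(1,2) by simp
    also have "\<dots> \<le> f (Z \<omega>)"
      using elim(3) f(2) by (rule monoD[rotated])
    finally show ?case .
  qed
qed

lemma (in prob_space) expectation_concave_le:
  fixes f :: "real \<Rightarrow> real"
  assumes f: "concave_on {0..} f" "mono f" "\<And>x. f x \<ge> 0" "f \<in> borel_measurable borel"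
    and Y: "integrable M Y" "AE \<omega> in M. Y \<omega> > 0"
  shows "expectation (\<lambda>\<omega>. f (Y \<omega>)) \<le> f (expectation Y)"
proof -
  have Y0: "AE \<omega> in M. Y \<omega> \<ge> 0"
    using Y(2) by eventually_elim simp
  have int: "integrable M (\<lambda>\<omega>. f (Y \<omega>))"
    by (rule integrable_concave_comp[OF f Y(1) Y0])
  have conv: "convex_on {0<..} (\<lambda>x. - f x)"
    by (rule convex_on_subset[of "{0..}"]) (use f(1) in \<open>auto simp: concave_on_def\<close>)
  have "- f (expectation Y) \<le> expectation (\<lambda>\<omega>. - f (Y \<omega>))"
    by (rule jensens_inequality[where I = "{0<..}"]) (use Y int conv in auto)
  then show ?thesis by simp
qed

text \<open>On an event of \<open>F\<close>, \<open>Z\<close> and its conditional expectation have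
  the same integral. Localising to \<open>B\<close> allows the step to be taken only where a stopped
  process is still running.\<close>

lemma (in finite_measure) set_integral_supermartingale_step:
  assumes "subalgebra M F" "integrable M Y" "integrable M Z" "B \<in> sets F"
    and le: "AE \<omega> in M. real_cond_exp M F Z \<omega> \<le> Y \<omega>"
  shows "(\<integral>\<omega>\<in>B. Z \<omega> \<partial>M) \<le> (\<integral>\<omega>\<in>B. Y \<omega> \<partial>M)"
proof -
  interpret S: finite_measure_subalgebra M F
    by unfold_locales (rule assms)
  have B: "B \<in> sets M"
    using assms by (auto simp: subalgebra_def)
  have "(\<integral>\<omega>\<in>B. Z \<omega> \<partial>M) = (\<integral>\<omega>\<in>B. real_cond_exp M F Z \<omega> \<partial>M)"
    using assms by (intro S.real_cond_exp_intA)
  also have "\<dots> \<le> (\<integral>\<omega>\<in>B. Y \<omega> \<partial>M)"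
    unfolding set_lebesgue_integral_def real_scaleR_def
  proof (rule integral_mono_AE)
    show "integrable M (\<lambda>\<omega>. indicator B \<omega> * real_cond_exp M F Z \<omega>)"
      "integrable M (\<lambda>\<omega>. indicator B \<omega> * Y \<omega>)"
      using integrable_mult_indicator[OF B] S.real_cond_exp_int(1)[OF assms(3)] assms(2)
      by fastforce+
    show "AE \<omega> in M. indicator B \<omega> * real_cond_exp M F Z \<omega> \<le> indicator B \<omega> * Y \<omega>"
      using le by eventually_elim (simp add: mult_left_mono)
  qed
  finally show ?thesis .
qed

lemma (in finite_measure) supermartingale_expectation_le:
  assumes "n \<le> T" "\<And>k. subalgebra M (F k)" "\<And>k. integrable M (Y k)"
    and "\<And>k. k < T \<Longrightarrow> AE \<omega> in M. real_cond_exp M (F k) (Y (Suc k)) \<omega> \<le> Y k \<omega>"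
  shows "(\<integral>\<omega>. Y T \<omega> \<partial>M) \<le> (\<integral>\<omega>. Y n \<omega> \<partial>M)"
  using assms(1,4)
proof (induction T rule: dec_induct)
  case (step T)
  \<comment> \<open>With the whole space as event, the localised step becomes an inequality of
    expectations.\<close>
  have "(\<integral>\<omega>\<in>space M. Y (Suc T) \<omega> \<partial>M) \<le> (\<integral>\<omega>\<in>space M. Y T \<omega> \<partial>M)"
  proof (rule set_integral_supermartingale_step[of "F T"])
    show "space M \<in> sets (F T)"
      using assms(2)[of T] by (metis sets.top subalgebra_def)
  qed (use assms step in auto)
  then have "(\<integral>\<omega>. Y (Suc T) \<omega> \<partial>M) \<le> (\<integral>\<omega>. Y T \<omega> \<partial>M)"
    using assms(3) by (simp add: set_integral_space)
  also have "\<dots> \<le> (\<integral>\<omega>. Y n \<omega> \<partial>M)"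
    using step by simp
  finally show ?case .
qed simp

lemma (in finite_measure) maximal_inequality_horizon:
  assumes F: "\<And>k. subalgebra M (F k)" "filtration (space M) F"
    and Y: "\<And>k. integrable M (Y k)" "\<And>k. Y k \<in> borel_measurable (F k)"
      "\<And>k. AE \<omega> in M. Y k \<omega> \<ge> (0::real)"
    and "n \<le> T"
    and super: "\<And>k. k < T \<Longrightarrow> AE \<omega> in M. real_cond_exp M (F k) (Y (Suc k)) \<omega> \<le> Y k \<omega>"
  shows "c * measure M {\<omega> \<in> space M. \<exists>k\<in>{n..T}. Y k \<omega> \<ge> c} \<le> (\<integral>\<omega>. Y n \<omega> \<partial>M)"
proof -
  define E where "E T = {\<omega> \<in> space M. \<exists>k\<in>{n..T}. Y k \<omega> \<ge> c}" for T
  \<comment> \<open>The process frozen at the value \<open>c\<close> once it has reached the level \<open>c\<close>.\<close>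
  define Z where "Z T \<omega> = indicator (E T) \<omega> * c + indicator (space M - E T) \<omega> * Y T \<omega>" for T \<omega>
  have spF: "space (F k) = space M" for k
    using F(1) by (simp add: subalgebra_def)
  \<comment> \<open>Passage up to time \<open>T\<close> is decided by the values up to
    \<open>T\<close>, all of which are \<open>F T\<close>-measurable because the filtration
    increases.\<close>
  have EF: "E T \<in> sets (F T)" for T
  proof -
    have "{\<omega> \<in> space (F T). Y k \<omega> \<ge> c} \<in> sets (F T)" if "k \<le> T" for k
    proof -
      have "{\<omega> \<in> space (F k). Y k \<omega> \<ge> c} \<in> sets (F k)"
        using Y(2)[of k] by measurable
      then show ?thesis
        using filtration.sets_F_mono[OF F(2) that] spF by auto
    qed
    moreover have "E T = (\<Union>k\<in>{n..T}. {\<omega> \<in> space (F T). Y k \<omega> \<ge> c})"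
      by (auto simp: E_def spF)
    ultimately show ?thesis
      by (auto intro!: sets.finite_UN)
  qed
  have E: "E T \<in> sets M" for T
    using EF F(1) by (auto simp: subalgebra_def)
  have int: "integrable M (\<lambda>\<omega>. indicator B \<omega> * Y k \<omega>)" if "B \<in> sets M" for B k
    using integrable_mult_indicator[OF that Y(1)[of k]] by simp
  have intc: "integrable M (\<lambda>\<omega>. indicator B \<omega> * c)" if "B \<in> sets M" for B
    using that by (simp add: less_top[symmetric])
  have intZ: "integrable M (Z T)" for T
    unfolding Z_def using E by (intro Bochner_Integration.integrable_add int intc) auto
  have "(\<integral>\<omega>. Z T \<omega> \<partial>M) \<le> (\<integral>\<omega>. Y n \<omega> \<partial>M)"
    using \<open>n \<le> T\<close> super
  proof (induction T rule: dec_induct)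
    case base
    \<comment> \<open>At time \<open>n\<close> freezing can only lower the value: on
      \<open>E n\<close> the level \<open>c\<close> replaces some
      \<open>Y n \<omega> \<ge> c\<close>.\<close>
    show ?case
      by (intro integral_mono intZ Y) (auto simp: Z_def E_def split: split_indicator)
  next
    case (step T)
    let ?B = "space M - E T"
    have B: "?B \<in> sets (F T)"
      using EF[of T] spF[of T] by (metis sets.compl_sets)
    have BM: "?B \<in> sets M"
      using E by auto
    \<comment> \<open>The supermartingale step is used only off \<open>E T\<close>, where the
      process is not yet frozen.\<close>
    have *: "(\<integral>\<omega>\<in>?B. Y (Suc T) \<omega> \<partial>M) \<le> (\<integral>\<omega>\<in>?B. Y T \<omega> \<partial>M)"
      by (rule set_integral_supermartingale_step[OF F(1) Y(1) Y(1) B]) (use step in auto)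
    have sub: "E T \<subseteq> E (Suc T)"
      by (force simp: E_def)
    \<comment> \<open>On a first passage at time \<open>Suc T\<close> the overshoot is cut back to
      \<open>c\<close>, so freezing again only lowers the value.\<close>
    have new: "Y (Suc T) \<omega> \<ge> c" if "\<omega> \<in> E (Suc T)" "\<omega> \<notin> E T" for \<omega>
      using that by (auto simp: E_def le_Suc_eq)
    have "(\<integral>\<omega>. Z (Suc T) \<omega> \<partial>M)
        \<le> (\<integral>\<omega>. indicator (E T) \<omega> * c + indicator ?B \<omega> * Y (Suc T) \<omega> \<partial>M)"
    proof (rule integral_mono[OF intZ])
      show "integrable M (\<lambda>\<omega>. indicator (E T) \<omega> * c + indicator ?B \<omega> * Y (Suc T) \<omega>)"
        using E BM by (intro Bochner_Integration.integrable_add int intc)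
      show "Z (Suc T) \<omega> \<le> indicator (E T) \<omega> * c + indicator ?B \<omega> * Y (Suc T) \<omega>"
        if "\<omega> \<in> space M" for \<omega>
        using that sub new by (auto simp: Z_def split: split_indicator)
    qed
    also have "\<dots> \<le> (\<integral>\<omega>. Z T \<omega> \<partial>M)"
      unfolding Z_def using * E BM int intc
      by (simp add: set_lebesgue_integral_def)
    also have "\<dots> \<le> (\<integral>\<omega>. Y n \<omega> \<partial>M)"
      using step by simp
    finally show ?case .
  qed
  \<comment> \<open>Here nonnegativity of \<open>Y T\<close> enters, to discard the part off
    \<open>E T\<close>.\<close>
  moreover have "(\<integral>\<omega>. indicator (E T) \<omega> * c \<partial>M) \<le> (\<integral>\<omega>. Z T \<omega> \<partial>M)"
  proof (rule integral_mono_AE[OF intc[OF E] intZ])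
    show "AE \<omega> in M. indicator (E T) \<omega> * c \<le> Z T \<omega>"
      using Y(3)[of T] by eventually_elim (auto simp: Z_def split: split_indicator)
  qed
  moreover have "(\<integral>\<omega>. indicator (E T) \<omega> * c \<partial>M) = c * measure M (E T)"
    using sets.Int_space_eq2[OF E] by (simp add: mult.commute)
  ultimately have "c * measure M (E T) \<le> (\<integral>\<omega>. Y n \<omega> \<partial>M)"
    by linarith
  then show ?thesis
    by (simp only: E_def)
qed

section \<open>Almost supermartingales\<close>

text \<open>The product up to \<open>Suc n\<close> involves only \<open>A 0\<close> to
  \<open>A n\<close> and is therefore \<open>F n\<close>-measurable, so it can be pulled out of the
  conditional expectation. Its last factor cancels \<open>1 + A n\<close>, and the noise only
  shrinks since the product is at least 1.\<close>

lemma (in prob_space) normalized_almost_supermartingale: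
  assumes F: "\<And>k. subalgebra M (F k)" "filtration (space M) F"
    and X: "nonneg_integrable_adapted M F X"
    and A: "nonneg_integrable_adapted M F A"
    and C: "nonneg_integrable_adapted M F C"
    and super: "\<And>n. AE \<omega> in M. real_cond_exp M (F n) (X (Suc n)) \<omega>
                      \<le> (1 + A n \<omega>) * X n \<omega> + C n \<omega>"
  defines "V \<equiv> \<lambda>n \<omega>. X n \<omega> / (\<Prod>i<n. 1 + A i \<omega>)"
  shows "V n \<in> borel_measurable (F n)" "integrable M (V n)" "\<omega> \<in> space M \<Longrightarrow> 0 \<le> V n \<omega>"
    "\<omega> \<in> space M \<Longrightarrow> V n \<omega> \<le> X n \<omega>"
    "AE \<omega> in M. real_cond_exp M (F n) (V (Suc n)) \<omega> \<le> V n \<omega> + C n \<omega>"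
proof -
  define P where "P n \<omega> = (\<Prod>i<n. 1 + A i \<omega>)" for n \<omega>
  have spF: "space (F k) = space M" for k
    using F(1) by (simp add: subalgebra_def)
  have A0: "A i \<omega> \<ge> 0" and X0: "X i \<omega> \<ge> 0" and C0: "C i \<omega> \<ge> 0" if "\<omega> \<in> space M" for i \<omega>
    using A X C that by (auto simp: nonneg_integrable_adapted_def)
  have Xm: "X i \<in> borel_measurable (F i)" and Xi: "integrable M (X i)" for i
    using X by (auto simp: nonneg_integrable_adapted_def)
  have P1: "P n \<omega> \<ge> 1" if "\<omega> \<in> space M" for n \<omega>
    unfolding P_def using A0[OF that] by (intro prod_ge_1) auto
  have Am: "A i \<in> borel_measurable (F n)" if "i \<le> n" for i n
  proof (rule measurable_from_subalg)
    show "subalgebra (F n) (F i)"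
      using filtration.sets_F_mono[OF F(2) that] spF by (simp add: subalgebra_def)
    show "A i \<in> borel_measurable (F i)"
      using A by (auto simp: nonneg_integrable_adapted_def)
  qed
  \<comment> \<open>The bound \<open>Suc n\<close> rather than \<open>n\<close> expresses
    predictability: \<open>P (Suc n)\<close> is already known at time \<open>n\<close>.\<close>
  have Pm: "P m \<in> borel_measurable (F n)" if "m \<le> Suc n" for m n
    unfolding P_def using that by (intro borel_measurable_prod borel_measurable_add Am) auto
  have Vm: "V n \<in> borel_measurable (F n)" for n
    unfolding V_def P_def[symmetric] by (intro borel_measurable_divide Xm Pm) auto
  have V0: "0 \<le> V n \<omega>" if "\<omega> \<in> space M" for n \<omega>
    unfolding V_def P_def[symmetric] using X0[OF that] P1[OF that, of n] by (simp add: order_trans[OF zero_le_one])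
  have VX: "V n \<omega> \<le> X n \<omega>" if "\<omega> \<in> space M" for n \<omega>
    unfolding V_def P_def[symmetric] using X0[OF that, of n] P1[OF that, of n]
    by (simp add: divide_le_eq mult_le_cancel_left1 split: if_splits)
  have Vi: "integrable M (V n)" for n
  proof (rule Bochner_Integration.integrable_bound[OF Xi[of n]])
    show "V n \<in> borel_measurable M"
      using measurable_from_subalg[OF F(1) Vm] .
    show "AE \<omega> in M. norm (V n \<omega>) \<le> norm (X n \<omega>)"
      using V0 VX X0 by (intro AE_I2) auto
  qed
  show "V n \<in> borel_measurable (F n)" "integrable M (V n)" "\<omega> \<in> space M \<Longrightarrow> 0 \<le> V n \<omega>"
    "\<omega> \<in> space M \<Longrightarrow> V n \<omega> \<le> X n \<omega>"
    by (fact Vm Vi V0 VX)+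
  interpret S: finite_measure_subalgebra M "F n"
    by unfold_locales (rule F)
  have VS: "V (Suc n) = (\<lambda>\<omega>. 1 / P (Suc n) \<omega> * X (Suc n) \<omega>)"
    by (simp add: V_def P_def)
  have "AE \<omega> in M. real_cond_exp M (F n) (V (Suc n)) \<omega>
      = 1 / P (Suc n) \<omega> * real_cond_exp M (F n) (X (Suc n)) \<omega>"
    unfolding VS
  proof (rule S.real_cond_exp_mult)
    show "(\<lambda>\<omega>. 1 / P (Suc n) \<omega>) \<in> borel_measurable (F n)"
      by (intro borel_measurable_divide borel_measurable_const Pm) simp
    show "integrable M (\<lambda>\<omega>. 1 / P (Suc n) \<omega> * X (Suc n) \<omega>)"
      using Vi[of "Suc n"] by (simp add: VS)
  qed (use Xi in auto)
  then show "AE \<omega> in M. real_cond_exp M (F n) (V (Suc n)) \<omega> \<le> V n \<omega> + C n \<omega>"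
    using super[of n] AE_space
  proof eventually_elim
    case (elim \<omega>)
    let ?P = "P (Suc n) \<omega>"
    have "1 / ?P * real_cond_exp M (F n) (X (Suc n)) \<omega>
        \<le> 1 / ?P * ((1 + A n \<omega>) * X n \<omega> + C n \<omega>)"
      using elim(2) P1[OF elim(3), of "Suc n"] by (intro mult_left_mono) auto
    also have "\<dots> = V n \<omega> + C n \<omega> / ?P"
      using A0[OF elim(3), of n] P1[OF elim(3), of n]
      by (simp add: V_def P_def add_divide_distrib)
    also have "C n \<omega> / ?P \<le> C n \<omega>"
      using C0[OF elim(3), of n] P1[OF elim(3), of "Suc n"]
      by (simp add: divide_le_eq mult_le_cancel_left1 split: if_splits)
    finally show ?case
      using elim(1) by simp
  qed
qed

text \<open>
  The constant \<open>\<delta>\<close> keeps the arguments of \<open>g\<close> in the open half-line, as the library version of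
  Jensen's inequality requires open intervals.
\<close>

lemma (in prob_space) concave_supermartingale_majorant:
  fixes g :: "real \<Rightarrow> real"
  assumes F: "\<And>k. subalgebra M (F k)" "filtration (space M) F"
    and X: "nonneg_integrable_adapted M F X"
    and A: "nonneg_integrable_adapted M F A"
    and C: "nonneg_integrable_adapted M F C"
    and super: "\<And>n. AE \<omega> in M. real_cond_exp M (F n) (X (Suc n)) \<omega>
                      \<le> (1 + A n \<omega>) * X n \<omega> + C n \<omega>"
    and g: "concave_on {0..} g" "mono g" "\<And>x. g x \<ge> 0" "g \<in> borel_measurable borel"
    and \<delta>: "\<delta> > 0"
  obtains Y where
    "\<And>k. integrable M (Y k)" "\<And>k. Y k \<in> borel_measurable (F k)" "\<And>k \<omega>. Y k \<omega> \<ge> 0"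
    "\<And>k. AE \<omega> in M. g (X k \<omega> / (\<Prod>i<k. 1 + A i \<omega>)) \<le> Y k \<omega>"
    "\<And>k. k < T \<Longrightarrow> AE \<omega> in M. real_cond_exp M (F k) (Y (Suc k)) \<omega> \<le> Y k \<omega>"
    "\<And>k. expectation (Y k) \<le> expectation (\<lambda>\<omega>. g (X k \<omega>)) + g (\<delta> + (\<Sum>i\<in>{k..<T}. expectation (C i)))"
proof -
  define V where "V n \<omega> = X n \<omega> / (\<Prod>i<n. 1 + A i \<omega>)" for n \<omega>
  note V = normalized_almost_supermartingale[OF F X A C super, folded V_def]
  \<comment> \<open>\<open>D k\<close> is the noise remaining before the horizon, and
    \<open>R k\<close> is its prediction at time \<open>k\<close>, shifted by \<delta>. Adding
    \<open>R k\<close> to \<open>V k\<close> compensates the drift \<open>C k\<close>.\<close>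
  define D where "D k \<omega> = (\<Sum>i\<in>{k..<T}. C i \<omega>)" for k \<omega>
  define R where "R k \<omega> = \<delta> + real_cond_exp M (F k) (D k) \<omega>" for k \<omega>
  define W where "W k \<omega> = V k \<omega> + R k \<omega>" for k \<omega>
  have X0: "X i \<omega> \<ge> 0" and C0: "C i \<omega> \<ge> 0" if "\<omega> \<in> space M" for i \<omega>
    using X C that by (auto simp: nonneg_integrable_adapted_def)
  have Xi: "integrable M (X i)" for i
    using X by (auto simp: nonneg_integrable_adapted_def)
  have Cm: "C i \<in> borel_measurable (F i)" and Ci: "integrable M (C i)" for i
    using C by (auto simp: nonneg_integrable_adapted_def)
  have Di: "integrable M (D k)" for k
    unfolding D_def using Ci by simp
  have S: "sigma_finite_subalgebra M (F k)" for k
    by (rule finite_measure_subalgebra_is_sigma_finite) (unfold_locales, rule F)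
  have Ri: "integrable M (R k)" for k
    unfolding R_def using sigma_finite_subalgebra.real_cond_exp_int(1)[OF S Di] by simp
  have R_pos: "AE \<omega> in M. R k \<omega> > 0" for k
  proof -
    have "AE \<omega> in M. real_cond_exp M (F k) (D k) \<omega> \<ge> 0"
      using C0 Di by (intro sigma_finite_subalgebra.real_cond_exp_pos[OF S] AE_I2)
        (auto simp: D_def intro!: sum_nonneg)
    then show ?thesis
      by eventually_elim (use \<delta> in \<open>simp add: R_def\<close>)
  qed
  have Wi: "integrable M (W k)" for k
    unfolding W_def using V(2) Ri by simp
  have W_pos: "AE \<omega> in M. W k \<omega> > 0" for k
    using R_pos[of k] AE_space
    by eventually_elim (simp add: W_def V(3) add_nonneg_pos)
  have W_super: "AE \<omega> in M. real_cond_exp M (F k) (W (Suc k)) \<omega> \<le> W k \<omega>" if "k < T" for k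
  proof -
    interpret S: sigma_finite_subalgebra M "F k" by (rule S)
    have nest: "subalgebra (F (Suc k)) (F k)"
      using F(1) filtration.sets_F_mono[OF F(2), of k "Suc k"] by (simp add: subalgebra_def)
    \<comment> \<open>Since \<open>k < T\<close>, the summand \<open>C k\<close> can be split off.
      It is known at time \<open>k\<close> and pays for the drift of \<open>V\<close>; the tower
      property handles the rest.\<close>
    have Dk: "D k = (\<lambda>\<omega>. C k \<omega> + D (Suc k) \<omega>)"
      using that by (simp add: D_def sum.atLeast_Suc_lessThan fun_eq_iff)
    have RS: "integrable M (real_cond_exp M (F (Suc k)) (D (Suc k)))"
      by (rule sigma_finite_subalgebra.real_cond_exp_int(1)[OF S Di])
    have "AE \<omega> in M. real_cond_exp M (F k) (W (Suc k)) \<omega>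
        = real_cond_exp M (F k) (V (Suc k)) \<omega> + real_cond_exp M (F k) (R (Suc k)) \<omega>"
      unfolding W_def by (rule S.real_cond_exp_add[OF V(2) Ri])
    moreover have "AE \<omega> in M. real_cond_exp M (F k) (R (Suc k)) \<omega> =
        real_cond_exp M (F k) (\<lambda>_. \<delta>) \<omega>
        + real_cond_exp M (F k) (real_cond_exp M (F (Suc k)) (D (Suc k))) \<omega>"
      unfolding R_def by (rule S.real_cond_exp_add) (simp_all add: RS)
    moreover have "AE \<omega> in M. real_cond_exp M (F k) (\<lambda>_. \<delta>) \<omega> = \<delta>"
      by (rule S.real_cond_exp_F_meas) simp_all
    moreover have "AE \<omega> in M. real_cond_exp M (F k) (real_cond_exp M (F (Suc k)) (D (Suc k))) \<omega>
        = real_cond_exp M (F k) (D (Suc k)) \<omega>"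
      by (rule S.real_cond_exp_nested_subalg[OF F(1) nest Di])
    moreover have "AE \<omega> in M. real_cond_exp M (F k) (D k) \<omega>
        = real_cond_exp M (F k) (C k) \<omega> + real_cond_exp M (F k) (D (Suc k)) \<omega>"
      unfolding Dk by (rule S.real_cond_exp_add[OF Ci Di])
    moreover have "AE \<omega> in M. real_cond_exp M (F k) (C k) \<omega> = C k \<omega>"
      by (rule S.real_cond_exp_F_meas[OF Ci Cm])
    ultimately show ?thesis
      using V(5)[of k] by eventually_elim (simp add: W_def R_def)
  qed
  have W0: "AE \<omega> in M. W k \<omega> \<ge> 0" for k
    using W_pos[of k] by eventually_elim simp
  have gWi: "integrable M (\<lambda>\<omega>. g (W k \<omega>))" for k
    by (rule integrable_concave_comp[OF g Wi W0])
  show thesis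
  proof
    show "integrable M (\<lambda>\<omega>. g (W k \<omega>))" for k
      by (rule gWi)
    have "W k \<in> borel_measurable (F k)" for k
      unfolding W_def R_def by (intro borel_measurable_add V(1)) simp_all
    then show "(\<lambda>\<omega>. g (W k \<omega>)) \<in> borel_measurable (F k)" for k
      using g(4) by (rule measurable_compose)
    show "g (W k \<omega>) \<ge> 0" for k \<omega>
      by (rule g)
    show "AE \<omega> in M. g (X k \<omega> / (\<Prod>i<k. 1 + A i \<omega>)) \<le> g (W k \<omega>)" for k
      using R_pos[of k] by eventually_elim (auto simp: W_def V_def intro: monoD[OF g(2)])
    show "AE \<omega> in M. real_cond_exp M (F k) (\<lambda>\<omega>. g (W (Suc k) \<omega>)) \<omega> \<le> g (W k \<omega>)" if "k < T" for k
      by (rule real_cond_exp_concave_le[OF F(1) g Wi W_pos W_super[OF that]])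
    show "expectation (\<lambda>\<omega>. g (W k \<omega>))
        \<le> expectation (\<lambda>\<omega>. g (X k \<omega>)) + g (\<delta> + (\<Sum>i\<in>{k..<T}. expectation (C i)))" for k
    proof -
      have R0: "AE \<omega> in M. R k \<omega> \<ge> 0"
        using R_pos[of k] by eventually_elim simp
      have gXi: "integrable M (\<lambda>\<omega>. g (X k \<omega>))"
        using X0 by (intro integrable_concave_comp[OF g Xi] AE_I2)
      have gRi: "integrable M (\<lambda>\<omega>. g (R k \<omega>))"
        by (rule integrable_concave_comp[OF g Ri R0])
      have "expectation (\<lambda>\<omega>. g (W k \<omega>)) \<le> expectation (\<lambda>\<omega>. g (X k \<omega>) + g (R k \<omega>))"
      proof (rule integral_mono_AE[OF gWi])
        show "integrable M (\<lambda>\<omega>. g (X k \<omega>) + g (R k \<omega>))"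
          using gXi gRi by simp
        show "AE \<omega> in M. g (W k \<omega>) \<le> g (X k \<omega>) + g (R k \<omega>)"
          using R0 AE_space
        proof eventually_elim
          case (elim \<omega>)
          \<comment> \<open>Subadditivity separates the process from the predicted noise.\<close>
          have "g (W k \<omega>) \<le> g (V k \<omega>) + g (R k \<omega>)"
            unfolding W_def using elim V(3) g by (intro concave_on_subadditive) auto
          moreover have "g (V k \<omega>) \<le> g (X k \<omega>)"
            using V(4) elim by (auto intro: monoD[OF g(2)])
          ultimately show ?case by simp
        qed
      qed
      \<comment> \<open>Jensen moves the expectation inside \<open>g\<close>; as conditioning
        preserves means, only the deterministic sum of the noise expectations remains.\<close>
      also have "\<dots> = expectation (\<lambda>\<omega>. g (X k \<omega>)) + expectation (\<lambda>\<omega>. g (R k \<omega>))"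
        using gXi gRi by simp
      also have "expectation (\<lambda>\<omega>. g (R k \<omega>)) \<le> g (expectation (R k))"
        by (rule expectation_concave_le[OF g Ri R_pos])
      also have "expectation (R k) = \<delta> + expectation (D k)"
        unfolding R_def using sigma_finite_subalgebra.real_cond_exp_int[OF S Di]
        by (simp add: prob_space)
      also have "expectation (D k) = (\<Sum>i\<in>{k..<T}. expectation (C i))"
        unfolding D_def using Ci by simp
      finally show ?thesis by simp
    qed
  qed
qed

theorem theorem2p8:
  fixes M :: "'a measure" and F :: "nat \<Rightarrow> 'a measure"
    and X A C :: "nat \<Rightarrow> 'a \<Rightarrow> real"
    and K :: real and chi :: "real \<Rightarrow> nat"
    and f \<psi> \<kappa> :: "real \<Rightarrow> real"
    and \<phi> :: "real \<Rightarrow> nat \<Rightarrow> nat"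
  assumes "prob_space M"
    and "filtration (space M) F" and "\<And>n. subalgebra M (F n)"
    and "nonneg_integrable_adapted M F X"
    and "nonneg_integrable_adapted M F A"
    and "nonneg_integrable_adapted M F C"
    and "\<And>n. AE \<omega> in M. real_cond_exp M (F n) (X (Suc n)) \<omega> \<le> (1 + A n \<omega>) * X n \<omega> + C n \<omega>"
    and "K \<ge> 1"
    and "AE \<omega> in M. convergent_prod (\<lambda>i. 1 + A i \<omega>) \<and> (\<Prod>i. 1 + A i \<omega>) < K"
    and "\<And>\<epsilon>. \<epsilon> > 0 \<Longrightarrow>
           summable (\<lambda>i. (\<integral>\<omega>. C (i + chi \<epsilon>) \<omega> \<partial>M)) \<and> (\<Sum>i. (\<integral>\<omega>. C (i + chi \<epsilon>) \<omega> \<partial>M)) < \<epsilon>"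
    and "sicc f \<psi> \<kappa>"
    and "liminf_modulus_in_expectation M (\<lambda>n \<omega>. f (X n \<omega>)) \<phi>"
  shows "let \<rho> = (\<lambda>\<epsilon>. \<phi> (\<epsilon> * \<psi> (inverse K) / 2) (chi (\<kappa> (\<epsilon> * \<psi> (inverse K) / 2))));
             \<rho>' = (\<lambda>l \<epsilon>. \<rho> (l * f \<epsilon>))
         in expectation_to_zero_with_rate M (\<lambda>n \<omega>. f (X n \<omega>)) \<rho>
            \<and> AE_to_zero_with_rate M X \<rho>'"
proof -
  interpret prob_space M by fact
  note X = assms(4) and A = assms(5) and C = assms(6) and super = assms(7) and K = assms(8)
  note F = assms(3,2)
  have X0: "X i \<omega> \<ge> 0" and A0: "A i \<omega> \<ge> 0" and C0: "C i \<omega> \<ge> 0" if "\<omega> \<in> space M" for i \<omega>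
    using X A C that by (auto simp: nonneg_integrable_adapted_def)
  have Xi: "integrable M (X i)" for i
    using X by (auto simp: nonneg_integrable_adapted_def)
  have [measurable]: "X i \<in> borel_measurable M" for i
    using Xi by auto
  have fnn: "f x \<ge> 0" if "x \<ge> 0" for x
    using assms(11) that by (auto simp: sicc_def)
  have fsm: "f x < f y" if "0 \<le> x" "x < y" for x y
    using assms(11) that by (auto simp: sicc_def strict_mono_on_def)
  have fcc: "concave_on {0..} f" and fct: "continuous_on {0..} f" and f0: "f 0 = 0"
    and fK: "\<And>x \<epsilon>. \<epsilon> > 0 \<Longrightarrow> x \<ge> 0 \<Longrightarrow> x < \<kappa> \<epsilon> \<Longrightarrow> f x < \<epsilon>"
    and f\<psi>: "\<And>x a. x \<ge> 0 \<Longrightarrow> 0 \<le> a \<Longrightarrow> a \<le> 1 \<Longrightarrow> f x * \<psi> a \<le> f (x * a)"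
    and \<kappa>: "\<And>\<epsilon>. \<epsilon> > 0 \<Longrightarrow> \<kappa> \<epsilon> > 0"
    using assms(11) by (auto simp: sicc_def)
  define p where "p = \<psi> (inverse K)"
  have p: "p > 0"
    using assms(11) K unfolding p_def sicc_def by (auto simp: inverse_le_1_iff)

  \<comment> \<open>Only the values of \<open>f\<close> on the half-line are constrained, so \<open>f\<close> itself need not be measurable.\<close>
  define g where "g x = f (max 0 x)" for x
  have gf: "g x = f x" if "x \<ge> 0" for x
    using that by (simp add: g_def)
  have fmono: "f x \<le> f y" if "0 \<le> x" "x \<le> y" for x y
    using fsm[of x y] that by (cases "x = y") auto
  have g: "concave_on {0..} g" "mono g" "g x \<ge> 0" "g \<in> borel_measurable borel" for x
  proof -
    show "concave_on {0..} g"
      using fcc by (simp add: concave_on_iff gf)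
    show "mono g"
      unfolding g_def by (intro monoI fmono) auto
    show "g x \<ge> 0"
      by (simp add: g_def fnn)
    have "continuous_on UNIV g"
      unfolding g_def by (rule continuous_on_compose2[OF fct]) (auto intro!: continuous_intros)
    then show "g \<in> borel_measurable borel"
      by (rule borel_measurable_continuous_onI)
  qed
  have gXf: "expectation (\<lambda>\<omega>. g (X k \<omega>)) = expectation (\<lambda>\<omega>. f (X k \<omega>))" for k
    by (intro Bochner_Integration.integral_cong) (auto simp: gf X0)
  have gXi: "integrable M (\<lambda>\<omega>. g (X k \<omega>))" for k
    using X0 by (intro integrable_concave_comp[OF g Xi] AE_I2)

  \<comment> \<open>Comparison of \<open>f (X k)\<close> with the normalised process\<close>
  have PK: "AE \<omega> in M. \<forall>k. f (X k \<omega>) * p \<le> g (X k \<omega> / (\<Prod>i<k. 1 + A i \<omega>))"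
    using assms(9) AE_space
  proof eventually_elim
    case (elim \<omega>)
    show ?case
    proof
      fix k
      let ?P = "\<Prod>i<k. 1 + A i \<omega>"
      \<comment> \<open>All factors are at least 1, so partial products stay below the infinite
        product.\<close>
      have "?P \<le> (\<Prod>i. 1 + A i \<omega>)"
        using A0[OF elim(2)] elim(1)
        by (intro prod_le_prodinf[OF convergent_prod_has_prod]) (auto simp: add_nonneg_nonneg)
      then have PK: "?P \<le> K"
        using elim(1) by simp
      have P1: "?P \<ge> 1"
        using A0[OF elim(2)] by (intro prod_ge_1) auto
      \<comment> \<open>Supermultiplicativity with \<open>a = inverse K\<close> is the source of the
        constant \<open>p\<close>.\<close>
      have "f (X k \<omega>) * p \<le> f (X k \<omega> * inverse K)"
        unfolding p_def using X0[OF elim(2)] K by (intro f\<psi>) (auto simp: inverse_le_1_iff)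
      also have "\<dots> = g (X k \<omega> * inverse K)"
        using X0[OF elim(2)] K by (simp add: gf)
      also have "X k \<omega> * inverse K \<le> X k \<omega> / ?P"
        using X0[OF elim(2), of k] PK P1 by (simp add: divide_inverse mult_left_mono le_imp_inverse_le)
      then have "g (X k \<omega> * inverse K) \<le> g (X k \<omega> / ?P)"
        by (rule monoD[OF g(2)])
      finally show "f (X k \<omega>) * p \<le> g (X k \<omega> / ?P)" .
    qed
  qed

  \<comment> \<open>Dominating supermartingales with small expectation at a controlled time\<close>
  define \<rho> where "\<rho> \<epsilon> = \<phi> (\<epsilon> * p / 2) (chi (\<kappa> (\<epsilon> * p / 2)))" for \<epsilon>
  define dominates where "dominates T Y \<longleftrightarrow>
      (\<forall>k. integrable M (Y k) \<and> Y k \<in> borel_measurable (F k) \<and> (\<forall>\<omega>. Y k \<omega> \<ge> 0) \<and>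
           (AE \<omega> in M. f (X k \<omega>) * p \<le> Y k \<omega>)) \<and>
      (\<forall>k<T. AE \<omega> in M. real_cond_exp M (F k) (Y (Suc k)) \<omega> \<le> Y k \<omega>)" for T Y
  have dominatesD: "integrable M (Y k)" "Y k \<in> borel_measurable (F k)" "Y k \<omega> \<ge> 0"
      "AE \<omega> in M. f (X k \<omega>) * p \<le> Y k \<omega>"
      "k < T \<Longrightarrow> AE \<omega> in M. real_cond_exp M (F k) (Y (Suc k)) \<omega> \<le> Y k \<omega>"
    if "dominates T Y" for T Y k \<omega>
    using that by (auto simp: dominates_def)
  \<comment> \<open>The order of quantifiers matters: \<open>Y\<close> depends on the horizon
    \<open>T\<close>, but \<open>n\<close> and the bound \<open>b\<close> do not, which later
    permits letting \<open>T\<close> tend to infinity.\<close>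
  have majorant: "\<exists>n b. n \<le> \<rho> \<epsilon> \<and> b < \<epsilon> * p \<and>
      (\<forall>T. \<exists>Y. dominates T Y \<and> expectation (Y n) \<le> b)" if "\<epsilon> > 0" for \<epsilon>
  proof -
    \<comment> \<open>The budget \<open>\<epsilon> * p\<close> is halved: one half for
      \<open>f (X n)\<close>, the other for the noise.\<close>
    define e where "e = \<epsilon> * p / 2"
    have e: "e > 0"
      using that p by (simp add: e_def)
    define N where "N = chi (\<kappa> e)"
    define s where "s = (\<Sum>i. expectation (C (i + N)))"
    \<comment> \<open>Half the gap between \<open>s\<close> and \<open>\<kappa> e\<close>, so that
      \<open>\<delta> + s\<close> stays below \<open>\<kappa> e\<close>.\<close>
    define \<delta> where "\<delta> = (\<kappa> e - s) / 2"
    have summ: "summable (\<lambda>i. expectation (C (i + N)))" and s: "s < \<kappa> e"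
      using assms(10)[OF \<kappa>[OF e]] by (auto simp: N_def s_def)
    have EC0: "expectation (C i) \<ge> 0" for i
      using C0 by (intro integral_nonneg_AE AE_I2)
    have s0: "s \<ge> 0"
      unfolding s_def using summ EC0 by (intro suminf_nonneg)
    have \<delta>: "\<delta> > 0" "\<delta> + s < \<kappa> e"
      using s by (auto simp: \<delta>_def field_simps)
    have "\<rho> \<epsilon> = \<phi> e N"
      by (simp add: \<rho>_def N_def e_def)
    then obtain n where n: "N \<le> n" "n \<le> \<rho> \<epsilon>" "expectation (\<lambda>\<omega>. f (X n \<omega>)) < e"
      using assms(12) e unfolding liminf_modulus_in_expectation_def
      by fastforce
    have tail: "(\<Sum>i\<in>{n..<T}. expectation (C i)) \<le> s" for T
    proof -
      \<comment> \<open>As \<open>n \<ge> N\<close>, the sum runs over part of the tail controlled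
        by \<open>chi\<close>; if \<open>T \<le> n\<close> it is empty.\<close>
      have "(\<Sum>i\<in>{n..<T}. expectation (C i)) \<le> (\<Sum>i\<in>{N..<N + T}. expectation (C i))"
        using n EC0 by (intro sum_mono2) auto
      also have "\<dots> = (\<Sum>i<T. expectation (C (i + N)))"
        using sum.shift_bounds_nat_ivl[of "\<lambda>i. expectation (C i)" 0 N T]
        by (simp add: atLeast0LessThan add.commute)
      also have "\<dots> \<le> s"
        unfolding s_def using summ EC0 by (intro sum_le_suminf) auto
      finally show ?thesis .
    qed
    define b where "b = expectation (\<lambda>\<omega>. f (X n \<omega>)) + g (\<delta> + s)"
    have "g (\<delta> + s) < e"
      using \<delta> s0 e by (simp add: gf fK)
    then have "b < \<epsilon> * p"
      using n(3) by (simp add: b_def e_def)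
    moreover have "\<exists>Y. dominates T Y \<and> expectation (Y n) \<le> b" for T
    proof -
      obtain Y where Y: "\<And>k. integrable M (Y k)" "\<And>k. Y k \<in> borel_measurable (F k)"
        "\<And>k \<omega>. Y k \<omega> \<ge> 0"
        "\<And>k. AE \<omega> in M. g (X k \<omega> / (\<Prod>i<k. 1 + A i \<omega>)) \<le> Y k \<omega>"
        "\<And>k. k < T \<Longrightarrow> AE \<omega> in M. real_cond_exp M (F k) (Y (Suc k)) \<omega> \<le> Y k \<omega>"
        "\<And>k. expectation (Y k) \<le> expectation (\<lambda>\<omega>. g (X k \<omega>))
                + g (\<delta> + (\<Sum>i\<in>{k..<T}. expectation (C i)))"
        by (rule concave_supermartingale_majorant[OF F X A C super g \<delta>(1), of T]) (rule that)
      have "AE \<omega> in M. f (X k \<omega>) * p \<le> Y k \<omega>" for k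
        using PK Y(4)[of k] by eventually_elim (meson order_trans)
      then have "dominates T Y"
        using Y by (simp add: dominates_def)
      moreover have "g (\<delta> + (\<Sum>i\<in>{n..<T}. expectation (C i))) \<le> g (\<delta> + s)"
        using tail by (intro monoD[OF g(2)]) simp
      then have "expectation (Y n) \<le> b"
        using Y(6)[of n] by (simp add: b_def gXf)
      ultimately show ?thesis
        by blast
    qed
    ultimately show ?thesis
      using n(2) by blast
  qed

  \<comment> \<open>Rate for the expectations\<close>
  have "expectation_to_zero_with_rate M (\<lambda>n \<omega>. f (X n \<omega>)) \<rho>"
    unfolding expectation_to_zero_with_rate_def
  proof (intro allI impI conjI)
    fix \<epsilon> :: real and m
    assume \<epsilon>: "\<epsilon> > 0" and m: "m \<ge> \<rho> \<epsilon>"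
    have "integrable M (\<lambda>\<omega>. g (X m \<omega>)) \<longleftrightarrow> integrable M (\<lambda>\<omega>. f (X m \<omega>))"
      by (intro Bochner_Integration.integrable_cong) (auto simp: gf X0)
    then show fXi: "integrable M (\<lambda>\<omega>. f (X m \<omega>))"
      using gXi by simp
    \<comment> \<open>The horizon is \<open>m\<close> itself: \<open>Y\<close> dominates
      \<open>p\<close> times \<open>f (X m)\<close> at time \<open>m\<close>, and its expectation
      has not grown since time \<open>n \<le> m\<close>.\<close>
    obtain n b Y where n: "n \<le> \<rho> \<epsilon>" and b: "b < \<epsilon> * p"
      and Y: "dominates m Y" "expectation (Y n) \<le> b"
      using majorant[OF \<epsilon>] by blast
    note D = dominatesD[OF Y(1)]
    have "expectation (\<lambda>\<omega>. f (X m \<omega>)) * p = expectation (\<lambda>\<omega>. f (X m \<omega>) * p)"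
      by simp
    also have "\<dots> \<le> expectation (Y m)"
      using fXi D(1,4) by (intro integral_mono_AE) auto
    also have "\<dots> \<le> expectation (Y n)"
      using n m D(1,5) by (intro supermartingale_expectation_le[where F = F] F) auto
    also have "\<dots> < \<epsilon> * p"
      using Y(2) b by simp
    finally show "expectation (\<lambda>\<omega>. f (X m \<omega>)) < \<epsilon>"
      using p by simp
  qed

  \<comment> \<open>Almost sure rate\<close>
  moreover have "AE_to_zero_with_rate M X (\<lambda>l \<epsilon>. \<rho> (l * f \<epsilon>))"
    unfolding AE_to_zero_with_rate_def
  proof (intro allI impI)
    fix l \<epsilon> :: real
    assume l: "l > 0" and \<epsilon>: "\<epsilon> > 0"
    have fe: "f \<epsilon> > 0"
      using fsm[of 0 \<epsilon>] \<epsilon> f0 by simp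
    let ?r = "\<rho> (l * f \<epsilon>)" and ?c = "f \<epsilon> * p"
    have c: "?c > 0"
      using fe p by simp
    \<comment> \<open>The accuracy \<open>l * f \<epsilon>\<close> is chosen so that Ville's
      inequality at level \<open>?c\<close> gives the probability bound
      \<open>b / ?c < l\<close>.\<close>
    obtain n b where n: "n \<le> ?r" and b: "b < l * f \<epsilon> * p"
      and Yex: "\<And>T. \<exists>Y. dominates T Y \<and> expectation (Y n) \<le> b"
      using majorant[OF mult_pos_pos[OF l fe]] by blast
    define E where "E T = {\<omega> \<in> space M. \<exists>k\<in>{n..T}. X k \<omega> \<ge> \<epsilon>}" for T
    have E: "range E \<subseteq> sets M"
      unfolding E_def by auto
    have bound: "prob (E T) \<le> b / ?c" if T: "T \<ge> n" for T
    proof -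
      obtain Y where Y: "dominates T Y" "expectation (Y n) \<le> b"
        using Yex[of T] by blast
      note D = dominatesD[OF Y(1)]
      have [measurable]: "Y k \<in> borel_measurable M" for k
        using D(1) by auto
      have "AE \<omega> in M. \<forall>k. f (X k \<omega>) * p \<le> Y k \<omega>"
        using D(4) by (simp add: AE_all_countable)
      \<comment> \<open>Monotonicity of \<open>f\<close> turns passage of \<open>X\<close> above
        \<epsilon> into passage of \<open>Y\<close> above \<open>?c\<close>.\<close>
      then have sub: "AE \<omega> in M. \<omega> \<in> E T \<longrightarrow> \<omega> \<in> {\<omega> \<in> space M. \<exists>k\<in>{n..T}. Y k \<omega> \<ge> ?c}"
      proof eventually_elim
        case (elim \<omega>)
        have "?c \<le> Y k \<omega>" if "X k \<omega> \<ge> \<epsilon>" for k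
        proof -
          have "?c \<le> f (X k \<omega>) * p"
            using that \<epsilon> p by (intro mult_right_mono fmono) auto
          then show ?thesis
            using elim by (meson order_trans)
        qed
        then show ?case
          by (auto simp: E_def)
      qed
      have "prob (E T) \<le> prob {\<omega> \<in> space M. \<exists>k\<in>{n..T}. Y k \<omega> \<ge> ?c}"
        by (rule finite_measure_mono_AE[OF sub]) measurable
      then have "?c * prob (E T) \<le> ?c * prob {\<omega> \<in> space M. \<exists>k\<in>{n..T}. Y k \<omega> \<ge> ?c}"
        using c by (intro mult_left_mono) auto
      also have "\<dots> \<le> expectation (Y n)"
        by (rule maximal_inequality_horizon[where F = F]) (use F D T in auto)
      finally show ?thesis
        using Y(2) c by (simp add: pos_le_divide_eq mult.commute)
    qed
    have inc: "incseq E"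
      by (rule incseq_SucI) (force simp: E_def)
    \<comment> \<open>Continuity from below carries the uniform bound, valid from
      \<open>T = n\<close> on, to the infinite horizon. The limit keeps only a weak inequality;
      strictness comes from the fixed \<open>b\<close>.\<close>
    have "prob (\<Union>T. E T) \<le> b / ?c"
      using finite_Lim_measure_incseq[OF E inc] bound
      by (intro LIMSEQ_le_const2) auto
    moreover have "prob {\<omega> \<in> space M. \<exists>k\<ge>?r. X k \<omega> \<ge> \<epsilon>} \<le> prob (\<Union>T. E T)"
    proof (rule finite_measure_mono)
      show "{\<omega> \<in> space M. \<exists>k\<ge>?r. X k \<omega> \<ge> \<epsilon>} \<subseteq> (\<Union>T. E T)"
        using n by (force simp: E_def)
      show "(\<Union>T. E T) \<in> events"
        using E by auto
    qed
    moreover have "b / ?c < l"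
      using b c by (simp add: pos_divide_less_eq mult.assoc)
    ultimately show "prob {\<omega> \<in> space M. \<exists>k\<ge>?r. X k \<omega> \<ge> \<epsilon>} < l"
      by linarith
  qed
  ultimately show ?thesis
    by (simp add: Let_def \<rho>_def[abs_def] p_def)
qed

end
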